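(* Let $f:\mathbb{R}\to\mathbb{R}$ be a flux function, let $\hat f:\mathbb{R}^{2k}\to\mathbb{R}$ ($k\ge1$) be a numerical flux consistent with $f$ that is an E flux, and let $h>0$. Let $\{\eta,q\}$ be any convex entropy pair for $u_t+f(u)_x=0$, i.e. $\eta''>0$ and $q'=\eta' f'$. Then there is a numerical entropy flux $\hat q$ consistent with $q$ such that every solution $(u_j(t))_{j\in\mathbb{Z}}$, $t>0$, of the semi-discrete E scheme $$\frac{d}{dt}u_j(t)=-\frac1h\bigl(\hat f_{j+\frac12}-\hat f_{j-\frac12}\bigr),\qquad j\in\mathbb{Z},\ t>0,$$ satisfies $$\frac{d}{dt}\eta(u_j(t))+\frac1h\bigl(\hat q_{j+\frac12}-\hat q_{j-\frac12}\bigr)\le 0\qquad\text{for all } j\in\mathbb{Z},\ t>0.$$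
   Context: Consider the scalar conservation law $u_t+f(u)_x=0$, $f:\mathbb{R}\to\mathbb{R}$ continuously differentiable; $\eta$ is twice continuously differentiable. A numerical flux consistent with $f$ is a Lipschitz continuous function $\hat f:\mathbb{R}^{2k}\to\mathbb{R}$ with $\hat f(u,\dots,u)=f(u)$ for all $u$; one writes $\hat f_{j+1/2}=\hat f(u_{j-k+1},\dots,u_{j+k})$. It is an E flux (and the scheme an E scheme) if for all real values of the arguments and every $u$ between $u_j$ and $u_{j+1}$, $\operatorname{sgn}(u_{j+1}-u_j)\,(\hat f_{j+1/2}-f(u))\le 0$, with $\operatorname{sgn}(0)=0$. A numerical entropy flux consistent with $q$ is a continuous function $\hat q:\mathbb{R}^{2k}\to\mathbb{R}$ with $\hat q(u,\dots,u)=q(u)$ for all $u$; one writes $\hat q_{j+1/2}=\hat q(u_{j-k+1},\dots,u_{j+k})$. *)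

theory Defs
  imports "HOL-Analysis.Analysis"
begin

text \<open>
  Points of \<open>\<real>\<close>-space of dimension \<open>2 * k\<close> are the points of the library space
  \<^term>\<open>Euclidean_space (2 * k)\<close>, i.e. functions \<^typ>\<open>nat \<Rightarrow> real\<close> vanishing at all
  indices \<open>\<ge> 2 * k\<close>; indices start at 0.
\<close>

definition const_vec :: "nat \<Rightarrow> real \<Rightarrow> nat \<Rightarrow> real" where
  "const_vec n v = (\<lambda>i. if i < n then v else 0)"

text \<open>
  The argument list \<open>(u\<^sub>j\<^sub>-\<^sub>k\<^sub>+\<^sub>1, \<dots>, u\<^sub>j\<^sub>+\<^sub>k)\<close>. Its entries \<open>u\<^sub>j\<close> and \<open>u\<^sub>j\<^sub>+\<^sub>1\<close> sit at
  the indices \<open>k - 1\<close> and \<open>k\<close>, and the half-integer value at \<open>j + 1/2\<close> of a function \<open>g\<close>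
  is \<open>half g k w j\<close>, so the one at \<open>j - 1/2\<close> is \<open>half g k w (j - 1)\<close>.
\<close>

definition stencil :: "nat \<Rightarrow> (int \<Rightarrow> real) \<Rightarrow> int \<Rightarrow> nat \<Rightarrow> real" where
  "stencil k w j = (\<lambda>i. if i < 2 * k then w (j - int k + 1 + int i) else 0)"

definition half :: "((nat \<Rightarrow> real) \<Rightarrow> real) \<Rightarrow> nat \<Rightarrow> (int \<Rightarrow> real) \<Rightarrow> int \<Rightarrow> real" where
  "half g k w j = g (stencil k w j)"

definition numerical_flux :: "nat \<Rightarrow> (real \<Rightarrow> real) \<Rightarrow> ((nat \<Rightarrow> real) \<Rightarrow> real) \<Rightarrow> bool" where
  "numerical_flux k f fh \<longleftrightarrow>
     (\<exists>L. \<forall>x \<in> topspace (Euclidean_space (2 * k)). \<forall>y \<in> topspace (Euclidean_space (2 * k)).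
        \<bar>fh x - fh y\<bar> \<le> L * L2_set (\<lambda>i. x i - y i) {..<2 * k}) \<and>
     (\<forall>v. fh (const_vec (2 * k) v) = f v)"

definition E_flux :: "nat \<Rightarrow> (real \<Rightarrow> real) \<Rightarrow> ((nat \<Rightarrow> real) \<Rightarrow> real) \<Rightarrow> bool" where
  "E_flux k f fh \<longleftrightarrow>
     (\<forall>x \<in> topspace (Euclidean_space (2 * k)). \<forall>v \<in> closed_segment (x (k - 1)) (x k).
        sgn (x k - x (k - 1)) * (fh x - f v) \<le> 0)"

definition convex_entropy_pair :: "(real \<Rightarrow> real) \<Rightarrow> (real \<Rightarrow> real) \<Rightarrow> (real \<Rightarrow> real) \<Rightarrow> bool" where
  "convex_entropy_pair f \<eta> q \<longleftrightarrow>
     \<eta> C1_differentiable_on UNIV \<and> deriv \<eta> C1_differentiable_on UNIV \<and>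
     (\<forall>v. deriv (deriv \<eta>) v > 0) \<and>
     (\<forall>v. (q has_real_derivative deriv \<eta> v * deriv f v) (at v))"

definition numerical_entropy_flux :: "nat \<Rightarrow> (real \<Rightarrow> real) \<Rightarrow> ((nat \<Rightarrow> real) \<Rightarrow> real) \<Rightarrow> bool" where
  "numerical_entropy_flux k q qh \<longleftrightarrow>
     continuous_map (Euclidean_space (2 * k)) euclideanreal qh \<and>
     (\<forall>v. qh (const_vec (2 * k) v) = q v)"

definition semidiscrete_solution ::
    "nat \<Rightarrow> real \<Rightarrow> ((nat \<Rightarrow> real) \<Rightarrow> real) \<Rightarrow> (int \<Rightarrow> real \<Rightarrow> real) \<Rightarrow> bool" where
  "semidiscrete_solution k h fh u \<longleftrightarrow>
     (\<forall>j. \<forall>t>0. (u j has_real_derivative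
        - (1 / h) * (half fh k (\<lambda>i. u i t) j - half fh k (\<lambda>i. u i t) (j - 1))) (at t))"

end

theory Submission
  imports Defs
begin

text \<open>
  Write \<open>a\<close>, \<open>b\<close> for the two middle arguments \<open>u\<^sub>j\<close>, \<open>u\<^sub>j\<^sub>+\<^sub>1\<close> of the numerical flux at \<open>j + 1/2\<close> and
  \<open>F\<close> for its value there. The entropy flux is
    \<open>q(a) + \<eta>'(a) (F - f(a))\<close>,
  the flux \<open>q\<close> corrected by the entropy variable \<open>\<eta>'\<close> times the difference between the numerical
  and the physical flux. It is continuous because a Lipschitz flux is continuous, and consistent
  because the correction vanishes on constant arguments.

  Consider the entropy potential \<open>\<psi>\<^sub>F(w) = q(w) + \<eta>'(w) (F - f(w))\<close>, so that the entropy flux is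
  \<open>\<psi>\<^sub>F(a)\<close>. Since \<open>q' = \<eta>' f'\<close>, its derivative is \<open>\<eta>''(w) (F - f(w))\<close>. For \<open>F\<close> the value of an
  E flux, this is \<open>\<le> 0\<close> between \<open>a\<close> and \<open>b\<close> if \<open>a < b\<close>, and \<open>\<ge> 0\<close> there if \<open>b < a\<close>. Hence
  \<open>\<psi>\<^sub>F(b) \<le> \<psi>\<^sub>F(a)\<close> whatever the order of \<open>a\<close> and \<open>b\<close> (lemma \<open>entropy_potential_E_le\<close>).

  In the entropy balance of cell \<open>j\<close>, with \<open>F\<close> and \<open>G\<close> the numerical fluxes at \<open>j + 1/2\<close> and \<open>j - 1/2\<close>,
  the time derivative contributes \<open>-\<eta>'(u\<^sub>j) (F - G)\<close>, which equals \<open>\<psi>\<^sub>G(u\<^sub>j) - \<psi>\<^sub>F(u\<^sub>j)\<close>. The flux at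
  \<open>j + 1/2\<close> contributes \<open>\<psi>\<^sub>F(u\<^sub>j)\<close>, so the right interface cancels exactly. The left one leaves
  \<open>\<psi>\<^sub>G(u\<^sub>j) - \<psi>\<^sub>G(u\<^sub>j\<^sub>-\<^sub>1)\<close>, which is nonpositive by the inequality above. (The overall factor is \<open>1/h\<close>.)
\<close>

text \<open>
  Squeezing \<open>g y - g x\<close> against \<open>B x y\<close>, which tends to \<open>0\<close> as \<open>y\<close> tends to \<open>x\<close>. With a multiple of the
  Euclidean norm of \<open>y - x\<close> as \<open>B x y\<close>, this turns the Lipschitz bound of a numerical flux into
  continuity for the product topology of the stencil space.
\<close>

lemma continuous_map_real_dominated:
  fixes g :: "'a \<Rightarrow> real"
  assumes cont: "\<And>x. x \<in> topspace X \<Longrightarrow> continuous_map X euclideanreal (B x)"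
    and diag: "\<And>x. x \<in> topspace X \<Longrightarrow> B x x = 0"
    and bound: "\<And>x y. x \<in> topspace X \<Longrightarrow> y \<in> topspace X \<Longrightarrow> \<bar>g y - g x\<bar> \<le> B x y"
  shows "continuous_map X euclideanreal g"
  unfolding continuous_map_atin limitin_canonical_iff
proof
  fix x assume x: "x \<in> topspace X"
  have "(B x \<longlongrightarrow> 0) (atin X x)"
    using limitin_continuous_map[OF cont[OF x] x diag[OF x]] by simp
  moreover have "\<forall>\<^sub>F y in atin X x. norm (g y - g x) \<le> B x y"
    using x bound[OF x] by (auto simp: eventually_atin intro!: exI[of _ "topspace X"])
  ultimately have "((\<lambda>y. g y - g x) \<longlongrightarrow> 0) (atin X x)"
    by (rule Lim_null_comparison[rotated])
  then show "(g \<longlongrightarrow> g x) (atin X x)"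
    by (simp add: LIM_zero_iff)
qed

lemma continuous_map_Euclidean_space_component:
  "continuous_map (Euclidean_space n) euclideanreal (\<lambda>x. x i)"
  unfolding Euclidean_space_def
  by (intro continuous_map_from_subtopology continuous_map_product_projection) simp

lemma numerical_flux_continuous_map:
  assumes "numerical_flux k f fh"
  shows "continuous_map (Euclidean_space (2 * k)) euclideanreal fh"
proof -
  obtain L where L: "\<And>x y. x \<in> topspace (Euclidean_space (2 * k)) \<Longrightarrow>
      y \<in> topspace (Euclidean_space (2 * k)) \<Longrightarrow>
      \<bar>fh x - fh y\<bar> \<le> L * L2_set (\<lambda>i. x i - y i) {..<2 * k}"
    using assms unfolding numerical_flux_def by blast
  let ?B = "\<lambda>x y. L * L2_set (\<lambda>i. y i - x i) {..<2 * k}"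
  show ?thesis
  proof (rule continuous_map_real_dominated[where B = ?B])
    fix x :: "nat \<Rightarrow> real"
    show "continuous_map (Euclidean_space (2 * k)) euclideanreal (?B x)"
      unfolding L2_set_def
      by (intro continuous_intros continuous_map_Euclidean_space_component) auto
    show "?B x x = 0"
      by (simp add: L2_set_def)
  qed (rule L)
qed

definition entropy_potential ::
    "(real \<Rightarrow> real) \<Rightarrow> (real \<Rightarrow> real) \<Rightarrow> (real \<Rightarrow> real) \<Rightarrow> real \<Rightarrow> real \<Rightarrow> real" where
  "entropy_potential f \<eta> q F w = q w + deriv \<eta> w * (F - f w)"

definition E_entropy_flux ::
    "nat \<Rightarrow> (real \<Rightarrow> real) \<Rightarrow> (real \<Rightarrow> real) \<Rightarrow> (real \<Rightarrow> real) \<Rightarrow> ((nat \<Rightarrow> real) \<Rightarrow> real) \<Rightarrow>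
      (nat \<Rightarrow> real) \<Rightarrow> real" where
  "E_entropy_flux k f \<eta> q fh x = entropy_potential f \<eta> q (fh x) (x (k - 1))"

lemma C1_differentiable_on_UNIV_DERIV:
  fixes f :: "real \<Rightarrow> real"
  assumes "f C1_differentiable_on UNIV"
  shows "(f has_real_derivative deriv f x) (at x)"
  using assms by (simp add: C1_differentiable_on_eq DERIV_deriv_iff_real_differentiable)

lemma convex_entropy_pairD:
  assumes "convex_entropy_pair f \<eta> q"
  shows "(\<eta> has_real_derivative deriv \<eta> v) (at v)"
    and "(deriv \<eta> has_real_derivative deriv (deriv \<eta>) v) (at v)"
    and "deriv (deriv \<eta>) v > 0"
    and "(q has_real_derivative deriv \<eta> v * deriv f v) (at v)"
  using assms C1_differentiable_on_UNIV_DERIV unfolding convex_entropy_pair_def by blast+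

text \<open>The terms \<open>q'\<close> and \<open>-\<eta>' f'\<close> cancel, by the compatibility of \<open>q\<close> with \<open>\<eta>\<close>.\<close>

lemma DERIV_entropy_potential:
  assumes "f C1_differentiable_on UNIV" and "convex_entropy_pair f \<eta> q"
  shows "(entropy_potential f \<eta> q F has_real_derivative deriv (deriv \<eta>) w * (F - f w)) (at w)"
  unfolding entropy_potential_def[abs_def]
  by (auto intro!: derivative_eq_intros C1_differentiable_on_UNIV_DERIV[OF assms(1)]
      convex_entropy_pairD[OF assms(2)] simp: algebra_simps)

text \<open>
  The E condition and \<open>\<eta>'' > 0\<close> make the potential monotone between the states on the two sides of
  the interface: nonincreasing if the right state is the larger one, nondecreasing if it is the smaller one.
\<close>

lemma entropy_potential_E_le:
  assumes f: "f C1_differentiable_on UNIV" and pair: "convex_entropy_pair f \<eta> q"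
    and E: "\<And>v. v \<in> closed_segment a b \<Longrightarrow> sgn (b - a) * (F - f v) \<le> 0"
  shows "entropy_potential f \<eta> q F b \<le> entropy_potential f \<eta> q F a"
proof (cases a b rule: linorder_cases)
  case less
  show ?thesis
  proof (rule DERIV_nonpos_imp_nonincreasing[where f = "entropy_potential f \<eta> q F"])
    fix w assume "a \<le> w" "w \<le> b"
    then have "F - f w \<le> 0"
      using E[of w] less by (simp add: closed_segment_eq_real_ivl)
    then show "\<exists>y. (entropy_potential f \<eta> q F has_real_derivative y) (at w) \<and> y \<le> 0"
      using DERIV_entropy_potential[OF f pair] convex_entropy_pairD(3)[OF pair, of w]
      by (intro exI conjI) (auto intro: mult_nonneg_nonpos)
  qed (use less in simp)
next
  case greater
  show ?thesis
  proof (rule DERIV_nonneg_imp_nondecreasing[where f = "entropy_potential f \<eta> q F"])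
    fix w assume "b \<le> w" "w \<le> a"
    then have "F - f w \<ge> 0"
      using E[of w] greater by (simp add: closed_segment_eq_real_ivl)
    then show "\<exists>y. (entropy_potential f \<eta> q F has_real_derivative y) (at w) \<and> y \<ge> 0"
      using DERIV_entropy_potential[OF f pair] convex_entropy_pairD(3)[OF pair, of w]
      by (intro exI conjI) auto
  qed (use greater in simp)
qed simp

lemma numerical_entropy_flux_E_entropy_flux:
  assumes f: "f C1_differentiable_on UNIV" and k: "k \<ge> 1"
    and flux: "numerical_flux k f fh" and pair: "convex_entropy_pair f \<eta> q"
  shows "numerical_entropy_flux k q (E_entropy_flux k f \<eta> q fh)"
proof -
  have comp: "continuous_map (Euclidean_space (2 * k)) euclideanreal (\<lambda>x. g (x (k - 1)))"
    if "\<And>v. isCont g v" for g :: "real \<Rightarrow> real"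
  proof -
    have "continuous_map euclideanreal euclideanreal g"
      using that by (simp add: continuous_on_eq_continuous_at)
    with continuous_map_Euclidean_space_component show ?thesis
      by (rule continuous_map_compose[unfolded o_def])
  qed
  have "isCont f v" "isCont q v" "isCont (deriv \<eta>) v" for v
    using C1_differentiable_on_UNIV_DERIV[OF f] convex_entropy_pairD[OF pair] DERIV_isCont by blast+
  then have "continuous_map (Euclidean_space (2 * k)) euclideanreal (E_entropy_flux k f \<eta> q fh)"
    unfolding E_entropy_flux_def[abs_def] entropy_potential_def
    by (intro continuous_intros comp numerical_flux_continuous_map[OF flux])
  moreover have "E_entropy_flux k f \<eta> q fh (const_vec (2 * k) v) = q v" for v
  proof -
    have "const_vec (2 * k) v (k - 1) = v"
      using k by (simp add: const_vec_def)
    then show ?thesis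
      using flux by (simp add: numerical_flux_def E_entropy_flux_def entropy_potential_def)
  qed
  ultimately show ?thesis
    by (simp add: numerical_entropy_flux_def)
qed

lemma stencil_in_Euclidean_space: "stencil k w j \<in> topspace (Euclidean_space (2 * k))"
  by (simp add: topspace_Euclidean_space stencil_def)

lemma stencil_middle:
  assumes "k \<ge> 1"
  shows "stencil k w j (k - 1) = w j" and "stencil k w j k = w (j + 1)"
  using assms by (auto simp: stencil_def of_nat_diff)

theorem theorem2p3:
  fixes f \<eta> q :: "real \<Rightarrow> real" and fh :: "(nat \<Rightarrow> real) \<Rightarrow> real" and k :: nat and h :: real
  assumes "f C1_differentiable_on UNIV"
    and "k \<ge> 1"
    and "numerical_flux k f fh"
    and "E_flux k f fh"
    and "h > 0"
    and "convex_entropy_pair f \<eta> q"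
  shows "\<exists>qh. numerical_entropy_flux k q qh \<and>
    (\<forall>u. semidiscrete_solution k h fh u \<longrightarrow>
      (\<forall>j. \<forall>t>0. (\<lambda>s. \<eta> (u j s)) differentiable (at t) \<and>
        deriv (\<lambda>s. \<eta> (u j s)) t
          + (1 / h) * (half qh k (\<lambda>i. u i t) j - half qh k (\<lambda>i. u i t) (j - 1)) \<le> 0))"
proof (intro exI[of _ "E_entropy_flux k f \<eta> q fh"] conjI allI impI)
  show "numerical_entropy_flux k q (E_entropy_flux k f \<eta> q fh)"
    using assms by (intro numerical_entropy_flux_E_entropy_flux)
next
  fix u :: "int \<Rightarrow> real \<Rightarrow> real" and j :: int and t :: real
  assume sol: "semidiscrete_solution k h fh u" and t: "t > 0"
  define w where "w = (\<lambda>i. u i t)"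
  define F where "F = half fh k w j"
  define G where "G = half fh k w (j - 1)"
  let ?\<psi> = "entropy_potential f \<eta> q"
  let ?qh = "E_entropy_flux k f \<eta> q fh"
  have "(u j has_real_derivative - (1 / h) * (F - G)) (at t)"
    using sol t unfolding semidiscrete_solution_def F_def G_def w_def by blast
  then have d: "((\<lambda>s. \<eta> (u j s)) has_real_derivative deriv \<eta> (w j) * (- (1 / h) * (F - G))) (at t)"
    unfolding w_def by (rule DERIV_chain2[OF convex_entropy_pairD(1)[OF assms(6)]])
  then show "(\<lambda>s. \<eta> (u j s)) differentiable (at t)"
    by (auto simp: real_differentiable_def)
  have right: "half ?qh k w j = ?\<psi> F (w j)" and left: "half ?qh k w (j - 1) = ?\<psi> G (w (j - 1))"
    unfolding half_def E_entropy_flux_def stencil_middle[OF assms(2)] F_def G_def by (rule refl)+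
  have "sgn (w j - w (j - 1)) * (G - f v) \<le> 0" if "v \<in> closed_segment (w (j - 1)) (w j)" for v
  proof -
    let ?x = "stencil k w (j - 1)"
    have "\<forall>v \<in> closed_segment (?x (k - 1)) (?x k). sgn (?x k - ?x (k - 1)) * (fh ?x - f v) \<le> 0"
      using assms(4) stencil_in_Euclidean_space unfolding E_flux_def by blast
    then show ?thesis
      using that unfolding stencil_middle[OF assms(2)] by (simp add: G_def half_def)
  qed
  then have diss: "?\<psi> G (w j) \<le> ?\<psi> G (w (j - 1))"
    by (rule entropy_potential_E_le[OF assms(1,6)])
  (* The q-terms of the two potentials at u_j cancel in the difference, and so do the f-terms. *)
  have "deriv \<eta> (w j) * (- (1 / h) * (F - G)) = (1 / h) * (?\<psi> G (w j) - ?\<psi> F (w j))"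
    by (simp add: entropy_potential_def divide_inverse algebra_simps)
  then have "deriv (\<lambda>s. \<eta> (u j s)) t + (1 / h) * (half ?qh k w j - half ?qh k w (j - 1))
      = (1 / h) * (?\<psi> G (w j) - ?\<psi> G (w (j - 1)))"
    unfolding DERIV_imp_deriv[OF d] right left by (simp add: algebra_simps)
  also have "\<dots> \<le> 0"
    using assms(5) diss by (intro mult_nonneg_nonpos) auto
  finally show "deriv (\<lambda>s. \<eta> (u j s)) t
      + (1 / h) * (half ?qh k (\<lambda>i. u i t) j - half ?qh k (\<lambda>i. u i t) (j - 1)) \<le> 0"
    unfolding w_def .
qed

end
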